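(* Suppose that for all integers $1\le t<k$ and all $g\in\mathcal G_t^\star$ one has $f(x|k,g,\phi_k)=f(x|t,g,\phi_t)$, and that for all $1\le t<k$ the ratio $f(g|k,\alpha_k)/f(g|t,\alpha_t)$ takes one and the same value $a_{kt}$ for all $g\in\mathcal G_t^\star$. Suppose that all mixture components are equivalent, and that $f(x|k,g,\phi_k)>0$ for all $k\ge1$ and $g\in\mathcal G_k$. Then for every $1\le k\le n$ $$f_k>\sum_{t=1}^{k-1}(-1)^{k+t+1}\binom kt a_{kt}f_t .$$
   Context: Fix $n\ge1$ and data $x=(x_1,\dots,x_n)$. For each integer $k\ge1$ consider a mixture model with $k$ components. Its $j$th component ($1\le j\le k$) has density $p_{jk}(\cdot|\theta_{jk})$, the parameter $\theta_{jk}$ has prior probability density $\pi_{jk}(\cdot|\phi_{jk})$ with fixed hyperparameter $\phi_{jk}$, parameters being independent over $j$; the weights have a Dirichlet prior with hyperparameters $\alpha_{jk}>0$. Write $\phi_k=(\phi_{1k},\dots,\phi_{kk})$, $\alpha_k=(\alpha_{1k},\dots,\alpha_{kk})$, $\alpha_{0k}=\sum_{j=1}^k\alpha_{jk}$. Let $\mathcal G_k=\{1,\dots,k\}^n$ be the set of membership vectors $g=(g_1,\dots,g_n)$, so that $\mathcal G_t\subset\mathcal G_k$ for $t<k$. For $g\in\mathcal G_k$ let $A_j=\{i:g_i=j\}$, $n_j=\operatorname{card}(A_j)$, $x^j=\{x_i:i\in A_j\}$. After integrating out weights and component parameters, $$f(g|k,\alpha_k)=\frac{\Gamma(\alpha_{0k})}{\Gamma(\alpha_{0k}+n)}\prod_{j=1}^k\frac{\Gamma(\alpha_{jk}+n_j)}{\Gamma(\alpha_{jk})},\qquad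 f(x|k,g,\phi_k)=\prod_{j=1}^k q_{jk}(x^j|\phi_{jk}),$$ $$q_{jk}(x^j|\phi_{jk})=\int\prod_{i\in A_j}p_{jk}(x_i|\theta)\,\pi_{jk}(\theta|\phi_{jk})\,d\theta,$$ which are assumed finite (and $q_{jk}=1$ when $A_j=\varnothing$). The marginal likelihood is $f_k=\sum_{g\in\mathcal G_k}f(x|k,g,\phi_k)f(g|k,\alpha_k)$. Standing assumptions: for all $k\ge2$ and $1\le j\le k-1$, $\alpha_{jk}=\alpha_{jj}$, $p_{jk}(\cdot|\cdot)=p_{jj}(\cdot|\cdot)$, $\pi_{jk}(\cdot|\cdot)=\pi_{jj}(\cdot|\cdot)$, $\phi_{jk}=\phi_{jj}$. Let $\mathcal G_t^\star=\{g\in\mathcal G_t:\exists\, i\text{ with }g_i=t\}$. Components $j$ and $k$ are equivalent if $\alpha_{jj}=\alpha_{kk}$, $p_{jj}(\cdot|\cdot)=p_{kk}(\cdot|\cdot)$, $\pi_{jj}(\cdot|\cdot)=\pi_{kk}(\cdot|\cdot)$ and $\phi_{jj}=\phi_{kk}$. *)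

theory Defs
  imports "HOL-Analysis.Analysis"
begin

definition prob_density :: "'a measure \<Rightarrow> ('a \<Rightarrow> real) \<Rightarrow> bool" where
  "prob_density M f \<longleftrightarrow> f \<in> borel_measurable M \<and> (\<forall>y\<in>space M. 0 \<le> f y) \<and>
     (\<integral>\<^sup>+ y. ennreal (f y) \<partial>M) = 1"

text \<open>Doubly indexed quantities carry the component \<open>j\<close> first and the number of components
  \<open>k\<close> second, with \<open>1 \<le> j \<le> k\<close>; values at other indices are never used. Data are
  \<open>x 1, \<dots>, x n\<close>.

  Membership vectors are extensional functions on \<open>{1..n}\<close>, so that
  \<open>memberships n t \<subseteq> memberships n k\<close> holds literally for \<open>t \<le> k\<close>.\<close>

definition memberships :: "nat \<Rightarrow> nat \<Rightarrow> (nat \<Rightarrow> nat) set" where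
  "memberships n k = {1..n} \<rightarrow>\<^sub>E {1..k}"

definition memberships_star :: "nat \<Rightarrow> nat \<Rightarrow> (nat \<Rightarrow> nat) set" where
  "memberships_star n t = {g \<in> memberships n t. \<exists>i\<in>{1..n}. g i = t}"

definition cell :: "nat \<Rightarrow> (nat \<Rightarrow> nat) \<Rightarrow> nat \<Rightarrow> nat set" where
  "cell n g j = {i \<in> {1..n}. g i = j}"

definition alpha_total :: "(nat \<Rightarrow> nat \<Rightarrow> real) \<Rightarrow> nat \<Rightarrow> real" where
  "alpha_total \<alpha> k = (\<Sum>j=1..k. \<alpha> j k)"

text \<open>\<open>f(g | k, \<alpha>\<^sub>k)\<close>, the Dirichlet-multinomial probability of \<open>g\<close>.\<close>

definition membership_prob :: "nat \<Rightarrow> (nat \<Rightarrow> nat \<Rightarrow> real) \<Rightarrow> nat \<Rightarrow> (nat \<Rightarrow> nat) \<Rightarrow> real" where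
  "membership_prob n \<alpha> k g =
     Gamma (alpha_total \<alpha> k) / Gamma (alpha_total \<alpha> k + real n) *
     (\<Prod>j=1..k. Gamma (\<alpha> j k + real (card (cell n g j))) / Gamma (\<alpha> j k))"

text \<open>The integrand and value of \<open>q\<^sub>j\<^sub>k(x\<^sup>j | \<phi>\<^sub>j\<^sub>k)\<close>, where \<open>x\<^sup>j\<close> is the family
  \<open>(x i)\<close> indexed by \<open>i \<in> A\<close>. The measure \<open>N\<close> plays the role of \<open>d\<theta>\<close>. For \<open>A = {}\<close> the
  integrand is the prior density, so the integral is 1. If components have different
  parameter spaces, \<open>N\<close> lives on their disjoint union, and each prior density vanishes
  off its own summand.\<close>

definition component_integrand ::
  "(nat \<Rightarrow> 'x) \<Rightarrow> (nat \<Rightarrow> nat \<Rightarrow> 'x \<Rightarrow> 'p \<Rightarrow> real) \<Rightarrow> (nat \<Rightarrow> nat \<Rightarrow> 'p \<Rightarrow> 'h \<Rightarrow> real) \<Rightarrow>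
   (nat \<Rightarrow> nat \<Rightarrow> 'h) \<Rightarrow> nat \<Rightarrow> nat \<Rightarrow> nat set \<Rightarrow> 'p \<Rightarrow> real" where
  "component_integrand x p \<pi> \<phi> j k A \<theta> = (\<Prod>i\<in>A. p j k (x i) \<theta>) * \<pi> j k \<theta> (\<phi> j k)"

definition component_marginal ::
  "'p measure \<Rightarrow> (nat \<Rightarrow> 'x) \<Rightarrow> (nat \<Rightarrow> nat \<Rightarrow> 'x \<Rightarrow> 'p \<Rightarrow> real) \<Rightarrow>
   (nat \<Rightarrow> nat \<Rightarrow> 'p \<Rightarrow> 'h \<Rightarrow> real) \<Rightarrow> (nat \<Rightarrow> nat \<Rightarrow> 'h) \<Rightarrow> nat \<Rightarrow> nat \<Rightarrow> nat set \<Rightarrow> real" where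
  "component_marginal N x p \<pi> \<phi> j k A = (\<integral>\<theta>. component_integrand x p \<pi> \<phi> j k A \<theta> \<partial>N)"

text \<open>\<open>f(x | k, g, \<phi>\<^sub>k)\<close> and \<open>f\<^sub>k\<close>.\<close>

definition data_likelihood ::
  "nat \<Rightarrow> 'p measure \<Rightarrow> (nat \<Rightarrow> 'x) \<Rightarrow> (nat \<Rightarrow> nat \<Rightarrow> 'x \<Rightarrow> 'p \<Rightarrow> real) \<Rightarrow>
   (nat \<Rightarrow> nat \<Rightarrow> 'p \<Rightarrow> 'h \<Rightarrow> real) \<Rightarrow> (nat \<Rightarrow> nat \<Rightarrow> 'h) \<Rightarrow> nat \<Rightarrow> (nat \<Rightarrow> nat) \<Rightarrow> real" where
  "data_likelihood n N x p \<pi> \<phi> k g = (\<Prod>j=1..k. component_marginal N x p \<pi> \<phi> j k (cell n g j))"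

definition marginal_likelihood ::
  "nat \<Rightarrow> 'p measure \<Rightarrow> (nat \<Rightarrow> 'x) \<Rightarrow> (nat \<Rightarrow> nat \<Rightarrow> 'x \<Rightarrow> 'p \<Rightarrow> real) \<Rightarrow>
   (nat \<Rightarrow> nat \<Rightarrow> 'p \<Rightarrow> 'h \<Rightarrow> real) \<Rightarrow> (nat \<Rightarrow> nat \<Rightarrow> 'h) \<Rightarrow> (nat \<Rightarrow> nat \<Rightarrow> real) \<Rightarrow> nat \<Rightarrow> real" where
  "marginal_likelihood n N x p \<pi> \<phi> \<alpha> k =
     (\<Sum>g\<in>memberships n k. data_likelihood n N x p \<pi> \<phi> k g * membership_prob n \<alpha> k g)"

definition equivalent_components ::
  "(nat \<Rightarrow> nat \<Rightarrow> 'x \<Rightarrow> 'p \<Rightarrow> real) \<Rightarrow> (nat \<Rightarrow> nat \<Rightarrow> 'p \<Rightarrow> 'h \<Rightarrow> real) \<Rightarrow>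
   (nat \<Rightarrow> nat \<Rightarrow> 'h) \<Rightarrow> (nat \<Rightarrow> nat \<Rightarrow> real) \<Rightarrow> nat \<Rightarrow> nat \<Rightarrow> bool" where
  "equivalent_components p \<pi> \<phi> \<alpha> j k \<longleftrightarrow>
     \<alpha> j j = \<alpha> k k \<and> p j j = p k k \<and> \<pi> j j = \<pi> k k \<and> \<phi> j j = \<phi> k k"

end

theory Submission
  imports Defs
begin

text \<open>When all components are equivalent, both the likelihood and the prior probability of a
  membership vector \<open>g\<close> factor over its cells, with factors that do not depend on the label of
  the cell and that equal 1 on the empty cell. Up to a positive constant \<open>C\<^sub>k\<close> (a quotient of
  Gamma values), \<open>f\<^sub>k\<close> is thus the sum \<open>W\<close>, over all labellings of the data by labels from
  \<open>{1..k}\<close>, of a product of set weights over the cells, and \<open>a\<^sub>k\<^sub>t = C\<^sub>k / C\<^sub>t\<close>.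

  Because empty cells have weight 1, \<open>W(S)\<close> is the sum over \<open>T \<subseteq> S\<close> of the contribution of
  the labellings whose set of used labels is exactly \<open>T\<close>. Inclusion-exclusion then expresses
  the contribution of the surjective labellings by the values \<open>W(T)\<close>, and these depend only on
  \<open>card T\<close>, which collects the subsets of size \<open>t\<close> into \<open>k choose t\<close> equal terms
  (\<open>surjective_sum_binomial\<close>). So the difference between the two sides of the asserted
  inequality is \<open>C\<^sub>k\<close> times the sum over surjective labellings. It is positive because
  \<open>k \<le> n\<close> guarantees that there is one.\<close>

section \<open>Sums over labellings of products over cells\<close>

definition cell_product :: "('a set \<Rightarrow> real) \<Rightarrow> 'a set \<Rightarrow> 'b set \<Rightarrow> ('a \<Rightarrow> 'b) \<Rightarrow> real" where
  "cell_product h I S g = (\<Prod>j\<in>S. h {i \<in> I. g i = j})"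

definition labelling_sum :: "('a set \<Rightarrow> real) \<Rightarrow> 'a set \<Rightarrow> 'b set \<Rightarrow> real" where
  "labelling_sum h I S = (\<Sum>g\<in>I \<rightarrow>\<^sub>E S. cell_product h I S g)"

definition surjective_sum :: "('a set \<Rightarrow> real) \<Rightarrow> 'a set \<Rightarrow> 'b set \<Rightarrow> real" where
  "surjective_sum h I S = (\<Sum>g\<in>{g \<in> I \<rightarrow>\<^sub>E S. g ` I = S}. cell_product h I S g)"

lemma cell_product_unused_labels:
  assumes "h {} = 1" "finite S" "T \<subseteq> S" "g ` I \<subseteq> T"
  shows "cell_product h I S g = cell_product h I T g"
  unfolding cell_product_def
proof (rule prod.mono_neutral_right)
  show "\<forall>j\<in>S - T. h {i \<in> I. g i = j} = 1"
  proof
    fix j assume "j \<in> S - T"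
    then have "{i \<in> I. g i = j} = {}" using assms by auto
    then show "h {i \<in> I. g i = j} = 1" using assms(1) by (simp only:)
  qed
qed (use assms in auto)

lemma labelling_sum_decompose:
  assumes "h {} = 1" "finite I" "finite S"
  shows "labelling_sum h I S = (\<Sum>T\<in>Pow S. surjective_sum h I T)"
proof -
  have "labelling_sum h I S
      = (\<Sum>T\<in>Pow S. \<Sum>g\<in>{g \<in> I \<rightarrow>\<^sub>E S. g ` I = T}. cell_product h I S g)"
    unfolding labelling_sum_def
    by (rule sum.group[symmetric]) (use assms in \<open>auto intro: finite_PiE\<close>)
  also have "\<dots> = (\<Sum>T\<in>Pow S. surjective_sum h I T)"
    unfolding surjective_sum_def
  proof (intro sum.cong refl)
    fix T assume T: "T \<in> Pow S"
    then show "{g \<in> I \<rightarrow>\<^sub>E S. g ` I = T} = {g \<in> I \<rightarrow>\<^sub>E T. g ` I = T}"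
      by (auto simp: PiE_iff)
    fix g assume "g \<in> {g \<in> I \<rightarrow>\<^sub>E T. g ` I = T}"
    then show "cell_product h I S g = cell_product h I T g"
      using T assms by (intro cell_product_unused_labels) auto
  qed
  finally show ?thesis .
qed

text \<open>Relabelling the cells along a bijection \<open>S \<rightarrow> T\<close> permutes the factors of each product,
  since the weight of a cell does not look at its label.\<close>

lemma labelling_sum_card_eq:
  assumes "finite S" "finite T" "card S = card T"
  shows "labelling_sum h I S = labelling_sum h I T"
proof -
  obtain \<sigma> where \<sigma>: "bij_betw \<sigma> S T"
    using finite_same_card_bij[OF assms] by blast
  let ?\<tau> = "inv_into S \<sigma>"
  have \<tau>: "bij_betw ?\<tau> T S" using \<sigma> by (rule bij_betw_inv_into)
  note inv = bij_betw_inv_into_left[OF \<sigma>] bij_betw_inv_into_right[OF \<sigma>]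
  show ?thesis unfolding labelling_sum_def
  proof (rule sum.reindex_bij_witness[where i = "\<lambda>g. \<lambda>i\<in>I. ?\<tau> (g i)" and j = "\<lambda>g. \<lambda>i\<in>I. \<sigma> (g i)"])
    fix g assume g: "g \<in> I \<rightarrow>\<^sub>E S"
    show "(\<lambda>i\<in>I. ?\<tau> ((\<lambda>i\<in>I. \<sigma> (g i)) i)) = g"
    proof
      fix i show "(\<lambda>i\<in>I. ?\<tau> ((\<lambda>i\<in>I. \<sigma> (g i)) i)) i = g i"
        using g inv by (cases "i \<in> I") (auto simp: PiE_iff extensional_def)
    qed
    show "(\<lambda>i\<in>I. \<sigma> (g i)) \<in> I \<rightarrow>\<^sub>E T"
      using g \<sigma> by (auto simp: PiE_iff dest: bij_betwE)
    have "cell_product h I T (\<lambda>i\<in>I. \<sigma> (g i))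
        = (\<Prod>j\<in>S. h {i \<in> I. (\<lambda>i\<in>I. \<sigma> (g i)) i = \<sigma> j})"
      unfolding cell_product_def by (rule prod.reindex_bij_betw[OF \<sigma>, symmetric])
    also have "\<dots> = cell_product h I S g"
      unfolding cell_product_def
    proof (rule prod.cong[OF refl])
      fix j assume "j \<in> S"
      then have "{i \<in> I. (\<lambda>i\<in>I. \<sigma> (g i)) i = \<sigma> j} = {i \<in> I. g i = j}"
        using g \<sigma> by (auto simp: PiE_iff bij_betw_def inj_on_def)
      then show "h {i \<in> I. (\<lambda>i\<in>I. \<sigma> (g i)) i = \<sigma> j} = h {i \<in> I. g i = j}"
        by (simp only:)
    qed
    finally show "cell_product h I T (\<lambda>i\<in>I. \<sigma> (g i)) = cell_product h I S g" .
  next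
    fix g assume g: "g \<in> I \<rightarrow>\<^sub>E T"
    show "(\<lambda>i\<in>I. \<sigma> ((\<lambda>i\<in>I. ?\<tau> (g i)) i)) = g"
    proof
      fix i show "(\<lambda>i\<in>I. \<sigma> ((\<lambda>i\<in>I. ?\<tau> (g i)) i)) i = g i"
        using g inv by (cases "i \<in> I") (auto simp: PiE_iff extensional_def)
    qed
    show "(\<lambda>i\<in>I. ?\<tau> (g i)) \<in> I \<rightarrow>\<^sub>E S"
      using g \<tau> by (auto simp: PiE_iff dest: bij_betwE)
  qed
qed

text \<open>Moebius inversion of \<open>labelling_sum_decompose\<close>, with the subsets collected by size. For
  \<open>h = 1\<close> this is the classical count of surjections from \<open>I\<close> onto a \<open>k\<close>-element set.\<close>

lemma surjective_sum_binomial: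
  assumes "h {} = 1" "finite I"
  shows "surjective_sum h I {1..k::nat}
    = (\<Sum>t\<le>k. (-1) ^ (k - t) * real (k choose t) * labelling_sum h I {1..t})"
proof -
  have "surjective_sum h I {1..k}
      = (\<Sum>T\<in>Pow {1..k}. (-1) ^ (card {1..k} - card T) * labelling_sum h I T)"
    by (rule inclusion_exclusion_mobius) (simp_all add: labelling_sum_decompose assms)
  also have "\<dots> = (\<Sum>T\<in>Pow {1..k}. (-1) ^ (k - card T) * labelling_sum h I {1..card T})"
  proof (intro sum.cong refl)
    fix T assume "T \<in> Pow {1..k}"
    then have "finite T" by (auto intro: finite_subset)
    then show "(-1) ^ (card {1..k} - card T) * labelling_sum h I T
        = (-1) ^ (k - card T) * labelling_sum h I {1..card T}"
      using labelling_sum_card_eq[of T "{1..card T}" h I] by simp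
  qed
  also have "\<dots> = (\<Sum>t\<le>k. \<Sum>T\<in>{T \<in> Pow {1..k}. card T = t}.
      (-1) ^ (k - card T) * labelling_sum h I {1..card T})"
  proof (rule sum.group[symmetric])
    show "card ` Pow {1..k} \<subseteq> {..k}"
    proof
      fix t assume "t \<in> card ` Pow {1..k}"
      then obtain T where "T \<subseteq> {1..k}" "t = card T" by auto
      then show "t \<in> {..k}" using card_mono[of "{1..k}" T] by simp
    qed
  qed auto
  also have "\<dots> = (\<Sum>t\<le>k. (-1) ^ (k - t) * real (k choose t) * labelling_sum h I {1..t})"
  proof (intro sum.cong refl)
    fix t
    have "(\<Sum>T\<in>{T \<in> Pow {1..k}. card T = t}.
        (-1) ^ (k - card T) * labelling_sum h I {1..card T})
      = (\<Sum>T\<in>{T \<in> Pow {1..k}. card T = t}. (-1) ^ (k - t) * labelling_sum h I {1..t})"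
      by (rule sum.cong) auto
    also have "\<dots> = (-1) ^ (k - t) * real (k choose t) * labelling_sum h I {1..t}"
      using n_subsets[of "{1..k}" t] by simp
    finally show "(\<Sum>T\<in>{T \<in> Pow {1..k}. card T = t}.
        (-1) ^ (k - card T) * labelling_sum h I {1..card T})
      = (-1) ^ (k - t) * real (k choose t) * labelling_sum h I {1..t}" .
  qed
  finally show ?thesis .
qed

lemma labelling_sum_no_labels:
  assumes "I \<noteq> {}"
  shows "labelling_sum h (I :: 'a set) ({} :: 'b set) = 0"
proof -
  have "I \<rightarrow>\<^sub>E {} = ({} :: ('a \<Rightarrow> 'b) set)"
    using assms by (auto simp: PiE_eq_empty_iff)
  then show ?thesis by (simp add: labelling_sum_def)
qed

lemma surjective_sum_pos:
  fixes k n :: nat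
  assumes "1 \<le> k" "k \<le> n" and "\<And>g. g \<in> {1..n} \<rightarrow>\<^sub>E {1..k} \<Longrightarrow> 0 < cell_product h {1..n} {1..k} g"
  shows "0 < surjective_sum h {1..n} {1..k}"
  unfolding surjective_sum_def
proof (rule sum_pos)
  show "finite {g \<in> {1..n} \<rightarrow>\<^sub>E {1..k}. g ` {1..n} = {1..k}}"
    by (rule finite_subset[of _ "{1..n} \<rightarrow>\<^sub>E {1..k}"]) (auto intro: finite_PiE)
  let ?g = "\<lambda>i\<in>{1..n}. min i k"
  have "?g ` {1..n} = {1..k}"
  proof
    show "{1..k} \<subseteq> ?g ` {1..n}"
    proof
      fix j assume "j \<in> {1..k}"
      then have "j = ?g j" "j \<in> {1..n}" using assms by auto
      then show "j \<in> ?g ` {1..n}" by blast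
    qed
  qed (use assms in auto)
  moreover have "?g \<in> {1..n} \<rightarrow>\<^sub>E {1..k}" using assms by auto
  ultimately show "{g \<in> {1..n} \<rightarrow>\<^sub>E {1..k}. g ` {1..n} = {1..k}} \<noteq> {}" by blast
qed (use assms(3) in auto)

section \<open>Mixtures of equivalent components\<close>

lemma integral_prob_density:
  assumes "prob_density M f"
  shows "(\<integral>y. f y \<partial>M) = 1"
proof -
  have "(\<integral>y. f y \<partial>M) = enn2real (\<integral>\<^sup>+ y. ennreal (f y) \<partial>M)"
    using assms by (intro integral_eq_nn_integral) (auto simp: prob_density_def)
  then show ?thesis using assms by (simp add: prob_density_def)
qed

text \<open>An empty cell contributes the total mass of the prior density. This is what makes the
  likelihood of \<open>g\<close> blind to labels that \<open>g\<close> does not use.\<close>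

lemma component_marginal_empty:
  assumes "prob_density N (\<lambda>\<theta>. \<pi> j k \<theta> (\<phi> j k))"
  shows "component_marginal N x p \<pi> \<phi> j k {} = 1"
  using integral_prob_density[OF assms]
  by (simp add: component_marginal_def component_integrand_def)

text \<open>The constant \<open>C\<^sub>k\<close>: the part of the Dirichlet-multinomial probability that does not depend
  on the membership vector, for common hyperparameter \<open>c\<close>.\<close>

definition gamma_ratio :: "nat \<Rightarrow> real \<Rightarrow> nat \<Rightarrow> real" where
  "gamma_ratio n c k = Gamma (real k * c) / Gamma (real k * c + real n)"

lemma gamma_ratio_pos:
  assumes "0 < c" "1 \<le> k"
  shows "0 < gamma_ratio n c k"
  using assms by (auto simp: gamma_ratio_def intro!: divide_pos_pos Gamma_real_pos add_pos_nonneg)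

lemma membership_prob_equal_alpha:
  assumes "\<And>j. 1 \<le> j \<Longrightarrow> j \<le> k \<Longrightarrow> \<alpha> j k = c"
  shows "membership_prob n \<alpha> k g
    = gamma_ratio n c k * cell_product (\<lambda>A. Gamma (c + real (card A)) / Gamma c) {1..n} {1..k} g"
  using assms
  by (simp add: membership_prob_def gamma_ratio_def cell_product_def alpha_total_def cell_def)

lemma cell_product_mult:
  "cell_product (\<lambda>A. h A * h' A) I S g = cell_product h I S g * cell_product h' I S g"
  by (simp add: cell_product_def prod.distrib)

theorem mainTheorem4:
  fixes n :: nat
    and M :: "'x measure" and N :: "'p measure"
    and x :: "nat \<Rightarrow> 'x"
    and p :: "nat \<Rightarrow> nat \<Rightarrow> 'x \<Rightarrow> 'p \<Rightarrow> real"
    and \<pi> :: "nat \<Rightarrow> nat \<Rightarrow> 'p \<Rightarrow> 'h \<Rightarrow> real"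
    and \<phi> :: "nat \<Rightarrow> nat \<Rightarrow> 'h"
    and \<alpha> a :: "nat \<Rightarrow> nat \<Rightarrow> real"
  assumes n: "n \<ge> 1"
    and data: "\<And>i. i \<in> {1..n} \<Longrightarrow> x i \<in> space M"
    and component_density:
      "\<And>j k \<theta>. 1 \<le> j \<Longrightarrow> j \<le> k \<Longrightarrow> \<theta> \<in> space N \<Longrightarrow> prob_density M (\<lambda>y. p j k y \<theta>)"
    and prior_density:
      "\<And>j k. 1 \<le> j \<Longrightarrow> j \<le> k \<Longrightarrow> prob_density N (\<lambda>\<theta>. \<pi> j k \<theta> (\<phi> j k))"
    and alpha_pos: "\<And>j k. 1 \<le> j \<Longrightarrow> j \<le> k \<Longrightarrow> \<alpha> j k > 0"
    and marginals_finite: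
      "\<And>j k g. 1 \<le> j \<Longrightarrow> j \<le> k \<Longrightarrow> g \<in> memberships n k \<Longrightarrow>
         integrable N (component_integrand x p \<pi> \<phi> j k (cell n g j))"
    and standing:
      "\<And>j k. 2 \<le> k \<Longrightarrow> 1 \<le> j \<Longrightarrow> j \<le> k - 1 \<Longrightarrow>
         \<alpha> j k = \<alpha> j j \<and> p j k = p j j \<and> \<pi> j k = \<pi> j j \<and> \<phi> j k = \<phi> j j"
    and likelihood_consistent:
      "\<And>t k g. 1 \<le> t \<Longrightarrow> t < k \<Longrightarrow> g \<in> memberships_star n t \<Longrightarrow>
         data_likelihood n N x p \<pi> \<phi> k g = data_likelihood n N x p \<pi> \<phi> t g"
    and ratio_constant:
      "\<And>t k g. 1 \<le> t \<Longrightarrow> t < k \<Longrightarrow> g \<in> memberships_star n t \<Longrightarrow>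
         membership_prob n \<alpha> k g / membership_prob n \<alpha> t g = a k t"
    and all_equivalent:
      "\<And>j k. 1 \<le> j \<Longrightarrow> 1 \<le> k \<Longrightarrow> equivalent_components p \<pi> \<phi> \<alpha> j k"
    and likelihood_pos:
      "\<And>k g. 1 \<le> k \<Longrightarrow> g \<in> memberships n k \<Longrightarrow> data_likelihood n N x p \<pi> \<phi> k g > 0"
  shows "\<forall>k. 1 \<le> k \<and> k \<le> n \<longrightarrow>
    marginal_likelihood n N x p \<pi> \<phi> \<alpha> k >
      (\<Sum>t=1..k-1. (-1) ^ (k + t + 1) * real (k choose t) * a k t *
         marginal_likelihood n N x p \<pi> \<phi> \<alpha> t)"
proof (intro allI impI, elim conjE)
  fix k assume k: "1 \<le> k" "k \<le> n"
  define c where "c = \<alpha> 1 1"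
  define q where "q = component_marginal N x p \<pi> \<phi> 1 1"
  define r where "r = (\<lambda>A :: nat set. Gamma (c + real (card A)) / Gamma c)"
  define h where "h = (\<lambda>A. q A * r A)"
  let ?W = "\<lambda>t. labelling_sum h {1..n} {1..t::nat}"
  have c: "0 < c" using alpha_pos[of 1 1] by (simp add: c_def)
  have same: "\<alpha> j m = c \<and> p j m = p 1 1 \<and> \<pi> j m = \<pi> 1 1 \<and> \<phi> j m = \<phi> 1 1"
    if "1 \<le> j" "j \<le> m" for j m
  proof -
    have "\<alpha> j m = \<alpha> j j \<and> p j m = p j j \<and> \<pi> j m = \<pi> j j \<and> \<phi> j m = \<phi> j j"
      using standing[of m j] that by (cases "j = m") auto
    then show ?thesis
      using all_equivalent[of j 1] that by (simp add: equivalent_components_def c_def)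
  qed
  have q_empty: "q {} = 1"
    unfolding q_def by (rule component_marginal_empty, rule prior_density) simp_all
  have r_empty: "r {} = 1" using Gamma_real_pos[OF c] by (simp add: r_def)
  have h_empty: "h {} = 1" by (simp add: h_def q_empty r_empty)
  have lik: "data_likelihood n N x p \<pi> \<phi> m g = cell_product q {1..n} {1..m} g" for m g
  proof -
    have "component_marginal N x p \<pi> \<phi> j m A = q A" if "j \<in> {1..m}" for j A
    proof -
      have "p j m = p 1 1" "\<pi> j m = \<pi> 1 1" "\<phi> j m = \<phi> 1 1" using same[of j m] that by auto
      then show ?thesis
        unfolding q_def component_marginal_def component_integrand_def by (simp only:)
    qed
    then show ?thesis by (simp add: data_likelihood_def cell_product_def cell_def)
  qed
  have prior: "membership_prob n \<alpha> m g = gamma_ratio n c m * cell_product r {1..n} {1..m} g" for m g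
    unfolding r_def by (rule membership_prob_equal_alpha) (use same in blast)
  have r_product_pos: "0 < cell_product r I S g" for I :: "nat set" and S :: "nat set" and g
    using c by (auto simp: cell_product_def r_def intro!: prod_pos divide_pos_pos Gamma_real_pos add_pos_nonneg)
  have f: "marginal_likelihood n N x p \<pi> \<phi> \<alpha> m = gamma_ratio n c m * ?W m" for m
    by (simp add: marginal_likelihood_def labelling_sum_def memberships_def lik prior h_def
        cell_product_mult sum_distrib_left mult_ac)
  have a: "a k t = gamma_ratio n c k / gamma_ratio n c t" if t: "1 \<le> t" "t < k" for t
  proof -
    \<comment> \<open>Any vector using the label \<open>t\<close> exhibits the ratio; the constant one always exists.\<close>
    define g where "g = (\<lambda>i\<in>{1..n}. t)"
    have g: "g \<in> memberships_star n t"
      using t n by (auto simp: g_def memberships_star_def memberships_def)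
    have "cell_product r {1..n} {1..k} g = cell_product r {1..n} {1..t} g"
      using t by (intro cell_product_unused_labels r_empty) (auto simp: g_def)
    then show ?thesis
      using ratio_constant[OF t g] r_product_pos[of "{1..n}" "{1..t}" g] by (simp add: prior)
  qed
  have "0 < surjective_sum h {1..n} {1..k}"
  proof (rule surjective_sum_pos[OF k])
    fix g :: "nat \<Rightarrow> nat" assume "g \<in> {1..n} \<rightarrow>\<^sub>E {1..k}"
    then have "0 < cell_product q {1..n} {1..k} g"
      using likelihood_pos[OF k(1), of g] by (simp add: lik memberships_def)
    then show "0 < cell_product h {1..n} {1..k} g"
      unfolding h_def cell_product_mult using r_product_pos by simp
  qed
  also have "surjective_sum h {1..n} {1..k} = (\<Sum>t\<le>k. (-1) ^ (k - t) * real (k choose t) * ?W t)"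
    by (rule surjective_sum_binomial) (auto simp: h_empty)
  also have "\<dots> = ?W k + (\<Sum>t=1..k-1. (-1) ^ (k - t) * real (k choose t) * ?W t)"
  proof -
    have "{..k} = insert 0 (insert k {1..k-1})" using k by auto
    moreover have "?W 0 = 0" using n by (simp add: labelling_sum_no_labels)
    ultimately show ?thesis using k by simp
  qed
  finally have "0 < gamma_ratio n c k * (?W k + (\<Sum>t=1..k-1. (-1) ^ (k - t) * real (k choose t) * ?W t))"
    using gamma_ratio_pos[OF c k(1)] by simp
  also have "\<dots> = gamma_ratio n c k * ?W k
      - (\<Sum>t=1..k-1. (-1) ^ (k + t + 1) * real (k choose t) * a k t * (gamma_ratio n c t * ?W t))"
  proof -
    have "gamma_ratio n c k * ((-1) ^ (k - t) * real (k choose t) * ?W t)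
        = - ((-1) ^ (k + t + 1) * real (k choose t) * a k t * (gamma_ratio n c t * ?W t))"
      if "t \<in> {1..k-1}" for t
    proof -
      have t: "1 \<le> t" "t < k" using that k by auto
      have "(-1 :: real) ^ (k - t) = (-1) ^ (k + t)"
        using t by (simp add: neg_one_power_add_eq_neg_one_power_diff)
      then show ?thesis using a[OF t] gamma_ratio_pos[OF c t(1), of n] by simp
    qed
    then have "gamma_ratio n c k * (\<Sum>t=1..k-1. (-1) ^ (k - t) * real (k choose t) * ?W t)
        = - (\<Sum>t=1..k-1. (-1) ^ (k + t + 1) * real (k choose t) * a k t * (gamma_ratio n c t * ?W t))"
      unfolding sum_distrib_left sum_negf[symmetric] by (intro sum.cong refl)
    then show ?thesis by (simp only: distrib_left diff_conv_add_uminus)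
  qed
  finally show "marginal_likelihood n N x p \<pi> \<phi> \<alpha> k >
      (\<Sum>t=1..k-1. (-1) ^ (k + t + 1) * real (k choose t) * a k t *
         marginal_likelihood n N x p \<pi> \<phi> \<alpha> t)"
    by (simp add: f)
qed

end
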